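(* Let $q=p^f$ be a prime power and $N>2$ an integer with $N\mid(q-1)$. Let $\gamma$ be a primitive element of $\mathbb{F}_q$, $C_i=\gamma^i\langle\gamma^N\rangle$ for $0\le i\le N-1$, and $\eta_a=\sum_{x\in C_a}\psi(x)$. Assume that $-1\in C_0$ and that the $\eta_a$, $0\le a\le N-1$, take exactly three rational values $\alpha_1,\alpha_2,\alpha_3$ with $\alpha_1-\alpha_2=-tu<0$ and $\alpha_3-\alpha_2=tv>0$, $t>0$. For $i=1,2,3$ let $I_i=\{a\in\mathbb{Z}_N:\eta_a=\alpha_i\}$, and set $R_0=\{0\}$, $R_i=\bigcup_{j\in I_i}C_j$ for $i=1,2,3$. For $0\le i\le 3$ define $\mathcal{R}_i=\{(x,y)\in\mathbb{F}_q\times\mathbb{F}_q: x-y\in R_i\}$. If $|I_1|=1$ or $|I_3|=1$, then $(\mathbb{F}_q,\{\mathcal{R}_i\}_{i=0}^3)$ is a self-dual three-class association scheme.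
   Context: $\psi$ is the canonical additive character of $\mathbb{F}_q$: $\psi(x)=\xi_p^{\mathrm{Tr}_{q/p}(x)}$. A (symmetric) association scheme with $d$ classes on a finite set $X$ is a partition of $X\times X$ into $R_0,\dots,R_d$ with $R_0$ the diagonal, each $R_i$ symmetric, and such that for all $i,j,k$ the number of $z$ with $(x,z)\in R_i$, $(z,y)\in R_j$ depends only on $i,j,k$ for $(x,y)\in R_k$. If $X$ is an abelian group and $R_i=\{(x,x+y):y\in D_i\}$ for a partition $D_0=\{0\},D_1,\dots,D_d$ of $X$, the scheme is a translation scheme; its dual is the translation scheme on the character group $\widehat X$ whose classes $D_0',\dots,D_d'$ are the equivalence classes of $\chi\sim\chi'$ iff $\chi(D_i)=\chi'(D_i)$ for all $i$. The scheme is self-dual if it is isomorphic to its dual. *)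

theory Defs
  imports "HOL-Analysis.Analysis"
begin

text \<open>The field F_q is modelled by a type 'a of class field and finite, with q = CARD('a) = p^f.
  Trace to the prime field: Tr(x) = sum_{i<f} x^(p^i).\<close>
definition trace_ff :: "nat \<Rightarrow> nat \<Rightarrow> 'a::field \<Rightarrow> 'a" where
  "trace_ff p f x = (\<Sum>i<f. x ^ (p ^ i))"

text \<open>Canonical additive character psi(x) = xi_p^{Tr(x)}, where Tr(x) in F_p is identified
  with the unique k < p such that of_nat k = Tr(x).\<close>
definition canon_add_char :: "nat \<Rightarrow> nat \<Rightarrow> 'a::field \<Rightarrow> complex" where
  "canon_add_char p f x =
     cis (2 * pi * real (THE k. k < p \<and> of_nat k = trace_ff p f x) / real p)"

definition primitive_element :: "'a::field \<Rightarrow> bool" where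
  "primitive_element g \<longleftrightarrow> g \<noteq> 0 \<and> (\<forall>x. x \<noteq> 0 \<longrightarrow> (\<exists>k::nat. x = g ^ k))"

definition cyc_class :: "'a::field \<Rightarrow> nat \<Rightarrow> nat \<Rightarrow> 'a set" where
  "cyc_class g N i = {g ^ (i + N * k) | k. True}"

definition gauss_period :: "nat \<Rightarrow> nat \<Rightarrow> 'a::{field,finite} \<Rightarrow> nat \<Rightarrow> nat \<Rightarrow> complex" where
  "gauss_period p f g N a = (\<Sum>x\<in>cyc_class g N a. canon_add_char p f x)"

definition assoc_scheme :: "'x set \<Rightarrow> (nat \<Rightarrow> ('x \<times> 'x) set) \<Rightarrow> nat \<Rightarrow> bool" where
  "assoc_scheme X R d \<longleftrightarrow>
     (\<forall>i\<le>d. R i \<noteq> {} \<and> R i \<subseteq> X \<times> X) \<and>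
     (\<forall>i\<le>d. \<forall>j\<le>d. i \<noteq> j \<longrightarrow> R i \<inter> R j = {}) \<and>
     (\<Union>i\<le>d. R i) = X \<times> X \<and>
     R 0 = Id_on X \<and>
     (\<forall>i\<le>d. sym (R i)) \<and>
     (\<forall>i\<le>d. \<forall>j\<le>d. \<forall>k\<le>d. \<exists>c::nat. \<forall>x y. (x, y) \<in> R k \<longrightarrow>
        card {z \<in> X. (x, z) \<in> R i \<and> (z, y) \<in> R j} = c)"

definition add_characters :: "('a::ab_group_add \<Rightarrow> complex) set" where
  "add_characters = {ch. (\<forall>x y. ch (x + y) = ch x * ch y) \<and> (\<forall>x. ch x \<noteq> 0)}"

definition translation_rel :: "(nat \<Rightarrow> 'a::ab_group_add set) \<Rightarrow> nat \<Rightarrow> ('a \<times> 'a) set" where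
  "translation_rel D i = {(x, x + y) | x y. y \<in> D i}"

definition dual_equiv :: "(nat \<Rightarrow> 'a::ab_group_add set) \<Rightarrow> nat \<Rightarrow>
    (('a \<Rightarrow> complex) \<times> ('a \<Rightarrow> complex)) set" where
  "dual_equiv D d = {(ch, ch'). ch \<in> add_characters \<and> ch' \<in> add_characters \<and>
       (\<forall>i\<le>d. (\<Sum>y\<in>D i. ch y) = (\<Sum>y\<in>D i. ch' y))}"

definition dual_rels :: "(nat \<Rightarrow> 'a::ab_group_add set) \<Rightarrow> nat \<Rightarrow>
    (('a \<Rightarrow> complex) \<times> ('a \<Rightarrow> complex)) set set" where
  "dual_rels D d = (\<lambda>E. {(ch, ch'). ch \<in> add_characters \<and> ch' \<in> add_characters \<and>
        (\<lambda>x. ch' x / ch x) \<in> E}) ` (add_characters // dual_equiv D d)"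

text \<open>Self-dual: isomorphic (bijection of point sets carrying the set of relations onto the
  set of relations, classes may be relabelled) to its dual.\<close>
definition self_dual_translation :: "(nat \<Rightarrow> 'a::ab_group_add set) \<Rightarrow> nat \<Rightarrow> bool" where
  "self_dual_translation D d \<longleftrightarrow>
     (\<exists>\<phi>. bij_betw \<phi> (UNIV :: 'a set) add_characters \<and>
        (\<lambda>R. map_prod \<phi> \<phi> ` R) ` {translation_rel D i | i. i \<le> d} = dual_rels D d)"

end

theory Submission
  imports Defs "HOL-Library.Real_Mod" "HOL-Number_Theory.Cong"
begin

text \<open>Let \<open>F(b)\<close> be the sum of \<open>\<psi>(b y)\<close> over \<open>y \<in> C\<^sub>0\<close>, so that
  \<open>R\<^sub>i\<close> is the set of \<open>x \<noteq> 0\<close> with \<open>F(x) = \<alpha>\<^sub>i\<close>. If \<open>R\<^sub>s = c C\<^sub>0\<close> is a single coset, then \<open>\<psi>\<^sub>b(R\<^sub>s) = F(c b)\<close>.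
  For \<open>b \<noteq> 0\<close> the sum of all \<open>\<psi>\<^sub>b(R\<^sub>i)\<close> is \<open>0\<close>, and the orthogonality relation for \<open>\<Sum>\<^sub>x F(x) F(b x)\<close> evaluates
  \<open>\<Sum>\<^sub>i \<alpha>\<^sub>i \<psi>\<^sub>b(R\<^sub>i)\<close> in terms of whether \<open>b \<in> C\<^sub>0\<close>, i.e. whether \<open>F(c b) = \<alpha>\<^sub>s\<close>. Hence all
  \<open>\<psi>\<^sub>b(R\<^sub>i)\<close> are functions of \<open>F(c b)\<close>, and the dual classes are the sets \<open>c\<^sup>-\<^sup>1 R\<^sub>i\<close>. Multiplication
  by \<open>c\<^sup>-\<^sup>1\<close> is thus an isomorphism onto the dual, and Fourier inversion shows that the
  intersection numbers are well defined.\<close>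

section \<open>Finite fields: prime subfield, trace and canonical character\<close>

text \<open>Multiplication by \<open>x \<noteq> 0\<close> permutes the nonzero elements; comparing
  their product before and after gives exponent \<open>CARD('a) - 1\<close>.\<close>

lemma finite_field_power_CARD:
  fixes x :: "'a::{field,finite}"
  shows "x ^ CARD('a) = x"
proof (cases "x = 0")
  case False
  have "bij_betw ((*) x) (UNIV - {0}) (UNIV - {0})"
    by (rule bij_betwI[of _ _ _ "\<lambda>y. y / x"]) (use False in auto)
  then have "(\<Prod>y\<in>UNIV - {0}. x * y) = \<Prod>(UNIV - {0})"
    by (rule prod.reindex_bij_betw)
  then have "x ^ (CARD('a) - 1) = 1"
    by (simp add: prod.distrib)
  then show ?thesis
    by (metis One_nat_def Suc_pred finite_UNIV_card_ge_0 finite_class.finite_UNIV mult.right_neutral power_Suc)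
qed simp

text \<open>Translation by 1 permutes the field, so summing all elements shows that
  \<open>p ^ f\<close> vanishes in it; the characteristic is thus a prime divisor of
  \<open>p ^ f\<close>.\<close>

lemma CHAR_finite_field:
  assumes "prime p" and "CARD('a::{field,finite}) = p ^ f"
  shows "CHAR('a) = p"
proof -
  have "(\<Sum>x\<in>(UNIV::'a set). x + 1) = \<Sum>UNIV"
    by (rule sum.reindex_bij_betw, rule bij_betwI[of _ _ _ "\<lambda>x. x - 1"]) auto
  then have "of_nat (p ^ f) = (0::'a)"
    using assms(2) by (simp add: sum.distrib)
  then have "CHAR('a) dvd p ^ f"
    by (simp only: of_nat_eq_0_iff_char_dvd)
  moreover have "prime CHAR('a)"
    by (intro prime_CHAR_semidom finite_imp_CHAR_pos) simp
  ultimately show ?thesis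
    using assms(1) by (metis prime_dvd_power primes_dvd_imp_eq)
qed

context
  fixes p f :: nat
  assumes prime_p: "prime p" and CARD_eq: "CARD('a::{field,finite}) = p ^ f"
begin

lemma of_nat_eq_iff_mod: "(of_nat m :: 'a) = of_nat n \<longleftrightarrow> m mod p = n mod p"
  unfolding of_nat_eq_iff_cong_CHAR CHAR_finite_field[OF prime_p CARD_eq] cong_def ..

text \<open>The polynomial \<open>X^p - X\<close> has at most \<open>p\<close> roots, and the
  \<open>p\<close> distinct elements of the prime field already are roots.\<close>

lemma frobenius_fixed_iff: "x ^ p = x \<longleftrightarrow> (\<exists>k<p. x = of_nat k)" for x :: 'a
proof -
  have p1: "p > 1"
    using prime_p by (rule prime_gt_1_nat)
  let ?P = "monom 1 p - [:0, 1:] :: 'a poly"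
  have deg: "degree ?P = p"
    using p1 by (subst diff_conv_add_uminus, subst degree_add_eq_left) (auto simp: degree_monom_eq)
  have roots: "{x. poly ?P x = 0} = {x. x ^ p = x}"
    by (simp add: poly_monom)
  have "card {x::'a. x ^ p = x} \<le> p"
  proof -
    have "?P \<noteq> 0"
      using deg p1 by (metis degree_0 not_one_less_zero)
    from card_poly_roots_bound[OF this] show ?thesis
      unfolding roots deg .
  qed
  moreover have "inj_on (of_nat :: nat \<Rightarrow> 'a) {..<p}"
    by (rule inj_onI) (simp add: of_nat_eq_iff_mod)
  then have "card ((of_nat :: nat \<Rightarrow> 'a) ` {..<p}) = p"
    by (simp add: card_image)
  moreover have "(of_nat k :: 'a) ^ p = of_nat k" for k
  proof -
    have "(\<Sum>i<k. 1 :: 'a) ^ p = (\<Sum>i<k. 1 ^ p)"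
      by (rule freshmans_dream_sum) (simp_all add: CHAR_finite_field[OF prime_p CARD_eq] prime_p)
    then show ?thesis
      by simp
  qed
  then have "(of_nat :: nat \<Rightarrow> 'a) ` {..<p} \<subseteq> {x. x ^ p = x}"
    by auto
  ultimately have "(of_nat :: nat \<Rightarrow> 'a) ` {..<p} = {x. x ^ p = x}"
    by (intro card_seteq) auto
  then have "x ^ p = x \<longleftrightarrow> x \<in> (of_nat :: nat \<Rightarrow> 'a) ` {..<p}"
    by simp
  then show ?thesis
    by (simp add: image_iff Bex_def)
qed

text \<open>Frobenius permutes the summands cyclically, because \<open>x ^ p ^ f = x\<close>. This
  puts the trace into the prime field, so that the \<open>THE\<close> in
  \<open>canon_add_char\<close> denotes.\<close>

lemma trace_ff_power: "trace_ff p f x ^ p = trace_ff p f x" for x :: 'a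
proof -
  have "trace_ff p f x ^ p = (\<Sum>i<f. x ^ p ^ Suc i)"
    unfolding trace_ff_def
    by (subst freshmans_dream_sum)
       (auto simp: CHAR_finite_field[OF prime_p CARD_eq] prime_p mult.commute simp flip: power_mult)
  \<comment> \<open>With the term of index 0 added, the sum over \<open>f + 1\<close> powers can be
    split at either end.\<close>
  also have "\<dots> + x ^ p ^ 0 = (\<Sum>i<Suc f. x ^ p ^ i)"
    by (subst sum.lessThan_Suc_shift) simp
  also have "\<dots> = trace_ff p f x + x ^ p ^ f"
    by (simp add: trace_ff_def)
  finally show ?thesis
    using finite_field_power_CARD[of x] by (simp add: CARD_eq)
qed

lemma trace_ff_add: "trace_ff p f (x + y) = trace_ff p f x + trace_ff p f y" for x y :: 'a
  unfolding trace_ff_def sum.distrib[symmetric]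
  by (intro sum.cong refl freshmans_dream') (auto simp: CHAR_finite_field[OF prime_p CARD_eq] prime_p)

text \<open>Otherwise the trace polynomial, nonzero since its coefficient at \<open>X\<close> is 1,
  would have \<open>p ^ f\<close> roots but degree at most \<open>p ^ (f - 1)\<close>.\<close>

lemma trace_ff_nonzero:
  assumes "f \<ge> 1"
  shows "\<exists>x::'a. trace_ff p f x \<noteq> 0"
proof (rule ccontr)
  assume "\<not> ?thesis"
  then have zero: "trace_ff p f x = 0" for x :: 'a
    by auto
  let ?P = "\<Sum>i<f. monom 1 (p ^ i) :: 'a poly"
  have p1: "p > 1"
    using prime_p by (rule prime_gt_1_nat)
  have "coeff ?P 1 = (\<Sum>i<f. if i = 0 then 1 else 0)"
  proof -
    have "p ^ i = 1 \<longleftrightarrow> i = 0" for i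
      using p1 by (simp add: power_eq_1_iff)
    then show ?thesis
      by (simp add: coeff_sum)
  qed
  also have "\<dots> = 1"
    using assms by simp
  finally have "?P \<noteq> 0"
    by (metis coeff_0 zero_neq_one)
  moreover have "{x. poly ?P x = 0} = UNIV"
    using zero[unfolded trace_ff_def] by (simp add: poly_sum poly_monom)
  ultimately have "p ^ f \<le> degree ?P"
    using card_poly_roots_bound[of ?P] by (simp add: CARD_eq)
  also have "degree ?P \<le> p ^ (f - 1)"
    using p1 by (intro degree_sum_le) (auto simp: degree_monom_eq power_increasing)
  also have "\<dots> < p ^ f"
    using p1 assms by (intro power_strict_increasing) auto
  finally show False
    by simp
qed

text \<open>Any representative \<open>k\<close> of the trace may replace the reduced one: a multiple
  of \<open>p\<close> only adds full turns to the angle. Additivity then needs no reduction modulo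
  \<open>p\<close>.\<close>

lemma canon_add_char_eqI:
  fixes x :: 'a
  assumes "of_nat k = trace_ff p f x"
  shows "canon_add_char p f x = cis (2 * pi * real k / real p)"
proof -
  have p0: "p > 0"
    using prime_p by (rule prime_gt_0_nat)
  have "(THE k. k < p \<and> of_nat k = trace_ff p f x) = k mod p"
  proof (rule the_equality)
    show "k mod p < p \<and> of_nat (k mod p) = trace_ff p f x"
      unfolding assms[symmetric] of_nat_eq_iff_mod using p0 by simp
  next
    fix m assume "m < p \<and> of_nat m = trace_ff p f x"
    then show "m = k mod p"
      unfolding assms[symmetric] of_nat_eq_iff_mod by (metis mod_less)
  qed
  moreover have "real k = real (k mod p) + real p * real (k div p)"
    by (metis mod_mult_div_eq of_nat_add of_nat_mult)
  then have "2 * pi * real k / real p = 2 * pi * real (k mod p) / real p + 2 * pi * real (k div p)"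
    using p0 by (simp add: field_simps)
  ultimately show ?thesis
    by (simp add: canon_add_char_def flip: cis_mult)
qed

lemma trace_ff_in_prime_field: "\<exists>k<p. of_nat k = trace_ff p f x" for x :: 'a
  using trace_ff_power[of x] frobenius_fixed_iff[of "trace_ff p f x"] by metis

lemma canon_add_char_add:
  "canon_add_char p f (x + y) = canon_add_char p f x * canon_add_char p f y" for x y :: 'a
proof -
  obtain k l where kl: "of_nat k = trace_ff p f x" "of_nat l = trace_ff p f y"
    using trace_ff_in_prime_field by meson
  then have "of_nat (k + l) = trace_ff p f (x + y)"
    by (simp add: trace_ff_add)
  from canon_add_char_eqI[OF kl(1)] canon_add_char_eqI[OF kl(2)] canon_add_char_eqI[OF this]
  show ?thesis
    by (simp add: cis_mult ring_distribs add_divide_distrib)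
qed

lemma canon_add_char_nontrivial:
  assumes "f \<ge> 1"
  shows "\<exists>x::'a. canon_add_char p f x \<noteq> 1"
proof -
  obtain x :: 'a where x: "trace_ff p f x \<noteq> 0"
    using trace_ff_nonzero[OF assms] by blast
  obtain k where k: "k < p" "of_nat k = trace_ff p f x"
    using trace_ff_in_prime_field by meson
  have "canon_add_char p f x \<noteq> 1"
  proof
    assume "canon_add_char p f x = 1"
    then obtain n where "2 * pi * real k / real p = of_int n * (2 * pi)"
      by (auto simp: canon_add_char_eqI[OF k(2)] cis_eq_1_iff)
    then have "real k = of_int n * real p"
      using k(1) by (simp add: field_simps)
    then have "int k = n * int p"
      by (metis of_int_eq_iff of_int_mult of_int_of_nat_eq)
    then have "int p dvd int k"
      by simp
    then have "k = 0"
      using k(1) by (auto dest: dvd_imp_le)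
    with k x show False
      by simp
  qed
  then show ?thesis ..
qed

end

section \<open>Characters of finite abelian groups\<close>

lemma add_character_zero: "ch \<in> add_characters \<Longrightarrow> ch 0 = 1"
proof -
  assume "ch \<in> add_characters"
  then have "ch (0 + 0) = ch 0 * ch 0" and "ch 0 \<noteq> 0"
    unfolding add_characters_def by blast+
  then show "ch 0 = 1"
    by simp
qed

text \<open>Shifting the summation variable by \<open>a\<close> multiplies the sum by
  \<open>ch a \<noteq> 1\<close>.\<close>

lemma sum_add_character:
  fixes ch :: "'a::{ab_group_add,finite} \<Rightarrow> complex"
  assumes "ch \<in> add_characters" and "ch a \<noteq> 1"
  shows "(\<Sum>x\<in>UNIV. ch x) = 0"
proof -
  have "(\<Sum>x\<in>UNIV. ch x) = (\<Sum>x\<in>UNIV. ch (a + x))"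
    by (rule sum.reindex_bij_betw[symmetric], rule bij_betwI[of _ _ _ "\<lambda>x. x - a"]) auto
  also have "\<dots> = ch a * (\<Sum>x\<in>UNIV. ch x)"
    using assms(1) by (simp add: add_characters_def sum_distrib_left)
  finally show ?thesis
    using assms(2) by simp
qed

lemma sum_partition:
  fixes g :: "'a::finite \<Rightarrow> 'b::comm_monoid_add" and D :: "nat \<Rightarrow> 'a set"
  assumes "\<And>x. \<exists>i\<le>d. x \<in> D i"
    and "\<And>i j x. i \<le> d \<Longrightarrow> j \<le> d \<Longrightarrow> x \<in> D i \<Longrightarrow> x \<in> D j \<Longrightarrow> i = j"
  shows "(\<Sum>x\<in>UNIV. g x) = (\<Sum>k\<le>d. \<Sum>x\<in>D k. g x)"
proof -
  have "UNIV = (\<Union>k\<in>{..d}. D k)"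
    using assms(1) by auto
  moreover have "sum g (\<Union>k\<in>{..d}. D k) = (\<Sum>k\<le>d. \<Sum>x\<in>D k. g x)"
    using assms(2) by (intro sum.UNION_disjoint) (auto 0 3)
  ultimately show ?thesis
    by simp
qed

section \<open>Fourier analysis with the twists of one nontrivial character\<close>

locale nontrivial_add_char =
  fixes \<psi> :: "'a::{field,finite} \<Rightarrow> complex"
  assumes add_character: "\<psi> \<in> add_characters"
    and nontrivial: "\<exists>x. \<psi> x \<noteq> 1"
begin

lemma char_add: "\<psi> (x + y) = \<psi> x * \<psi> y"
  using add_character by (auto simp: add_characters_def)

lemma char_nonzero [simp]: "\<psi> x \<noteq> 0"
  using add_character by (auto simp: add_characters_def)

lemma char_zero [simp]: "\<psi> 0 = 1"
  using add_character by (rule add_character_zero)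

lemma char_diff: "\<psi> (x - y) = \<psi> x / \<psi> y"
  using char_add[of "x - y" y] by (simp add: field_simps)

lemma twist_add_character: "(\<lambda>y. \<psi> (b * y)) \<in> add_characters"
  by (auto simp: add_characters_def char_add ring_distribs)

lemma sum_twist: "(\<Sum>x\<in>UNIV. \<psi> (b * x)) = (if b = 0 then of_nat CARD('a) else 0)"
proof (cases "b = 0")
  case False
  obtain a where "\<psi> a \<noteq> 1"
    using nontrivial by blast
  then show ?thesis
    using sum_add_character[OF twist_add_character, of b "a / b"] False by simp
qed simp

text \<open>If two twists agree, the twist by \<open>b - b'\<close> is constantly 1, so its sum is
  not 0 and \<open>sum_twist\<close> leaves only \<open>b - b' = 0\<close>.\<close>

lemma inj_twist: "inj (\<lambda>b y. \<psi> (b * y))"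
proof (rule injI)
  fix b b' assume eq: "(\<lambda>y. \<psi> (b * y)) = (\<lambda>y. \<psi> (b' * y))"
  have "\<psi> ((b - b') * y) = 1" for y
    using fun_cong[OF eq, of y] by (simp add: left_diff_distrib char_diff)
  then have "(\<Sum>y\<in>UNIV. \<psi> ((b - b') * y)) = of_nat CARD('a)"
    by simp
  then show "b = b'"
    by (simp add: sum_twist split: if_splits)
qed

text \<open>Fourier inversion exhibits any character as a combination of twists, so it is not orthogonal
  to all of them.\<close>
lemma add_character_is_twist:
  assumes ch: "ch \<in> add_characters"
  shows "\<exists>b. ch = (\<lambda>y. \<psi> (b * y))"
proof -
  \<comment> \<open>Summing over \<open>b\<close> first kills every \<open>x \<noteq> 0\<close>,
    leaving \<open>CARD('a)\<close>; hence some inner sum is nonzero.\<close>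
  have "(\<Sum>b\<in>UNIV. \<Sum>x\<in>UNIV. ch x / \<psi> (b * x)) = (\<Sum>x\<in>UNIV. ch x * (\<Sum>b\<in>UNIV. \<psi> (- x * b)))"
    by (subst sum.swap) (simp add: sum_distrib_left char_diff[of 0, simplified] field_simps)
  also have "\<dots> = (\<Sum>x\<in>(UNIV::'a set). if x = 0 then of_nat CARD('a) else 0)"
    unfolding sum_twist by (intro sum.cong) (auto simp: add_character_zero[OF ch])
  also have "\<dots> \<noteq> 0"
    by simp
  finally obtain b where b: "(\<Sum>x\<in>UNIV. ch x / \<psi> (b * x)) \<noteq> 0"
    by (meson sum.not_neutral_contains_not_neutral)
  \<comment> \<open>This quotient is a character with nonzero sum, hence trivial.\<close>
  have "(\<lambda>x. ch x / \<psi> (b * x)) \<in> add_characters"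
    using ch by (auto simp: add_characters_def char_add ring_distribs)
  then have "ch x / \<psi> (b * x) = 1" for x
    using sum_add_character b by metis
  then have "ch = (\<lambda>y. \<psi> (b * y))"
    by (auto simp: fun_eq_iff)
  then show ?thesis ..
qed

lemma bij_twist: "bij_betw (\<lambda>b y. \<psi> (b * y)) UNIV add_characters"
  unfolding bij_betw_def using inj_twist twist_add_character add_character_is_twist by blast

text \<open>Orthogonality of the twists detects \<open>u + v = x - y\<close>, and
  \<open>z = x - u\<close> turns the solutions into the points counted on the left.\<close>

lemma card_decompositions:
  "of_nat CARD('a) * of_nat (card {z. x - z \<in> A \<and> z - y \<in> B}) =
     (\<Sum>b\<in>UNIV. (\<Sum>u\<in>A. \<psi> (b * u)) * (\<Sum>v\<in>B. \<psi> (b * v)) * \<psi> (- b * (x - y)))"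
proof -
  have "(\<Sum>b\<in>UNIV. (\<Sum>u\<in>A. \<psi> (b * u)) * (\<Sum>v\<in>B. \<psi> (b * v)) * \<psi> (- b * (x - y)))
    = (\<Sum>b\<in>UNIV. \<Sum>(u, v)\<in>A \<times> B. \<psi> ((u + v - (x - y)) * b))"
  proof (rule sum.cong)
    fix b
    have "(\<Sum>u\<in>A. \<psi> (b * u)) * (\<Sum>v\<in>B. \<psi> (b * v)) = (\<Sum>(u, v)\<in>A \<times> B. \<psi> (b * u) * \<psi> (b * v))"
      by (simp add: sum_product sum.cartesian_product)
    also have "\<dots> * \<psi> (- b * (x - y)) = (\<Sum>(u, v)\<in>A \<times> B. \<psi> ((u + v - (x - y)) * b))"
      unfolding sum_distrib_right
      by (intro sum.cong) (auto simp: algebra_simps simp flip: char_add)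
    finally show "(\<Sum>u\<in>A. \<psi> (b * u)) * (\<Sum>v\<in>B. \<psi> (b * v)) * \<psi> (- b * (x - y)) = \<dots>" .
  qed simp
  also have "\<dots> = (\<Sum>(u, v)\<in>A \<times> B. if u + v = x - y then of_nat CARD('a) else 0)"
    by (subst sum.swap, intro sum.cong) (auto simp: sum_twist)
  also have "\<dots> = of_nat CARD('a) * of_nat (card {(u, v) \<in> A \<times> B. u + v = x - y})"
    by (simp add: case_prod_unfold sum.If_cases Int_def mem_Times_iff)
  also have "card {(u, v) \<in> A \<times> B. u + v = x - y} = card {z. x - z \<in> A \<and> z - y \<in> B}"
    by (rule bij_betw_same_card, rule bij_betwI[of "\<lambda>(u, v). x - u" _ _ "\<lambda>z. (x - z, z - y)"])
       (auto simp: algebra_simps)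
  finally show ?thesis ..
qed

end

section \<open>Self-dual partitions give self-dual translation schemes\<close>

text \<open>The condition \<open>dual\<close> says that the dual partition, transported to the field by
  \<open>b \<mapsto> \<psi> (b * _)\<close>, is the dilate of the partition by \<open>1 / c\<close>.\<close>
locale self_dual_partition = nontrivial_add_char \<psi> for \<psi> :: "'a::{field,finite} \<Rightarrow> complex" +
  fixes D :: "nat \<Rightarrow> 'a set" and d :: nat and c :: 'a
  assumes c_nonzero: "c \<noteq> 0"
    and D_0: "D 0 = {0}"
    and D_nonempty: "\<And>i. i \<le> d \<Longrightarrow> D i \<noteq> {}"
    and D_disjoint: "\<And>i j x. i \<le> d \<Longrightarrow> j \<le> d \<Longrightarrow> x \<in> D i \<Longrightarrow> x \<in> D j \<Longrightarrow> i = j"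
    and D_cover: "\<And>x. \<exists>i\<le>d. x \<in> D i"
    and D_uminus: "\<And>i x. i \<le> d \<Longrightarrow> x \<in> D i \<Longrightarrow> - x \<in> D i"
    and dual: "\<And>b b'. (\<forall>i\<le>d. (\<Sum>y\<in>D i. \<psi> (b * y)) = (\<Sum>y\<in>D i. \<psi> (b' * y))) \<longleftrightarrow>
                 (\<exists>k\<le>d. c * b \<in> D k \<and> c * b' \<in> D k)"
begin

lemma sum_class_cong:
  assumes "i \<le> d" "k \<le> d" "c * b \<in> D k" "c * b' \<in> D k"
  shows "(\<Sum>y\<in>D i. \<psi> (b * y)) = (\<Sum>y\<in>D i. \<psi> (b' * y))"
  using dual assms by blast

text \<open>By \<open>card_decompositions\<close> the count is a Fourier transform of a product of
  class sums. That product is constant on the dual classes, and summing a twist over such a class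
  again depends only on the class of \<open>x - y\<close>.\<close>

lemma intersection_number:
  assumes ij: "i \<le> d" "j \<le> d" and l: "l \<le> d" "x - y \<in> D l" "x' - y' \<in> D l"
  shows "card {z. x - z \<in> D i \<and> z - y \<in> D j} = card {z. x' - z \<in> D i \<and> z - y' \<in> D j}"
proof -
  define g where "g b = (\<Sum>u\<in>D i. \<psi> (b * u)) * (\<Sum>v\<in>D j. \<psi> (b * v))" for b
  define r where "r k = (SOME y. y \<in> D k)" for k
  have r: "r k \<in> D k" if "k \<le> d" for k
    using D_nonempty[OF that] by (simp add: r_def some_in_eq)
  have inversion: "(\<Sum>b\<in>UNIV. g b * \<psi> (- b * w)) = (\<Sum>k\<le>d. g (r k / c) * (\<Sum>y\<in>D k. \<psi> ((- w / c) * y)))"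
    for w
  proof -
    \<comment> \<open>The substitution \<open>b = y / c\<close> carries the dual classes to the
      classes \<open>D k\<close>, on which \<open>y \<mapsto> g (y / c)\<close> is constant.\<close>
    have "(\<Sum>b\<in>UNIV. g b * \<psi> (- b * w)) = (\<Sum>y\<in>UNIV. g (y / c) * \<psi> (- (y / c) * w))"
      by (rule sum.reindex_bij_betw[symmetric], rule bij_betwI[of _ _ _ "\<lambda>x. x * c"])
         (use c_nonzero in auto)
    also have "\<dots> = (\<Sum>k\<le>d. \<Sum>y\<in>D k. g (y / c) * \<psi> (- (y / c) * w))"
      using D_cover D_disjoint by (rule sum_partition)
    also have "\<dots> = (\<Sum>k\<le>d. \<Sum>y\<in>D k. g (r k / c) * \<psi> ((- w / c) * y))"
    proof (intro sum.cong refl)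
      fix k y assume k: "k \<in> {..d}" "y \<in> D k"
      then have "g (y / c) = g (r k / c)"
        using sum_class_cong[OF ij(1), of k "y / c" "r k / c"]
          sum_class_cong[OF ij(2), of k "y / c" "r k / c"] r[of k] c_nonzero
        by (simp add: g_def)
      then show "g (y / c) * \<psi> (- (y / c) * w) = g (r k / c) * \<psi> ((- w / c) * y)"
        by (simp add: mult.commute)
    qed
    finally show ?thesis
      by (simp add: sum_distrib_left)
  qed
  have "(\<Sum>b\<in>UNIV. g b * \<psi> (- b * (x - y))) = (\<Sum>b\<in>UNIV. g b * \<psi> (- b * (x' - y')))"
  proof -
    have "(\<Sum>z\<in>D k. \<psi> ((- (x - y) / c) * z)) = (\<Sum>z\<in>D k. \<psi> ((- (x' - y') / c) * z))"
      if "k \<le> d" for k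
      \<comment> \<open>The parameter here is \<open>- (x - y) / c\<close>; multiplied by
        \<open>c\<close> it lies in \<open>D l\<close> by symmetry of the class.\<close>
      using D_uminus[OF l(1) l(2)] D_uminus[OF l(1) l(3)] c_nonzero
      by (intro sum_class_cong[OF that l(1)]) auto
    then show ?thesis
      unfolding inversion by (intro sum.cong) auto
  qed
  then have "of_nat CARD('a) * of_nat (card {z. x - z \<in> D i \<and> z - y \<in> D j}) =
      (of_nat CARD('a) * of_nat (card {z. x' - z \<in> D i \<and> z - y' \<in> D j}) :: complex)"
    unfolding card_decompositions g_def .
  then show ?thesis
    by simp
qed

theorem assoc_scheme_partition: "assoc_scheme UNIV (\<lambda>i. {(x, y). x - y \<in> D i}) d"
  unfolding assoc_scheme_def
proof (intro conjI allI impI)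
  fix i assume i: "i \<le> d"
  show "{(x, y). x - y \<in> D i} \<noteq> {}"
  proof -
    obtain w where "w \<in> D i"
      using D_nonempty[OF i] by blast
    then have "(w, 0) \<in> {(x, y). x - y \<in> D i}"
      by simp
    then show ?thesis
      by blast
  qed
  show "sym {(x, y). x - y \<in> D i}"
  proof (rule symI)
    fix x y assume "(x, y) \<in> {(x, y). x - y \<in> D i}"
    then show "(y, x) \<in> {(x, y). x - y \<in> D i}"
      using D_uminus[OF i, of "x - y"] by simp
  qed
next
  fix i j assume "i \<le> d" "j \<le> d" "i \<noteq> j"
  then show "{(x, y). x - y \<in> D i} \<inter> {(x, y). x - y \<in> D j} = {}"
    using D_disjoint by auto
next
  show "(\<Union>i\<le>d. {(x, y). x - y \<in> D i}) = UNIV \<times> UNIV"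
    using D_cover by auto
  show "{(x, y). x - y \<in> D 0} = Id_on UNIV"
    by (auto simp: D_0)
next
  fix i j l assume le: "i \<le> d" "j \<le> d" "l \<le> d"
  show "\<exists>n. \<forall>x y. (x, y) \<in> {(x, y). x - y \<in> D l} \<longrightarrow>
      card {z \<in> UNIV. (x, z) \<in> {(x, y). x - y \<in> D i} \<and> (z, y) \<in> {(x, y). x - y \<in> D j}} = n"
  proof -
    obtain w where "w \<in> D l"
      using D_nonempty[OF le(3)] by blast
    then show ?thesis
      \<comment> \<open>The constant is read off at the sample pair \<open>(w, 0)\<close>.\<close>
      using intersection_number[OF le, where x' = w and y' = 0]
      by (intro exI[of _ "card {z. w - z \<in> D i \<and> z - 0 \<in> D j}"]) simp
  qed
qed simp

theorem self_dual_partition: "self_dual_translation D d"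
proof -
  \<comment> \<open>The division by \<open>c\<close> cancels the dilation in \<open>dual\<close>, so
    that \<open>\<phi>\<close> maps each \<open>D k\<close> exactly onto a dual class.\<close>
  define \<phi> where "\<phi> x = (\<lambda>y. \<psi> (x / c * y))" for x
  have bij: "bij_betw \<phi> UNIV add_characters"
  proof -
    have "bij_betw (\<lambda>x. x / c) UNIV UNIV"
      by (rule bij_betwI[of _ _ _ "\<lambda>x. x * c"]) (use c_nonzero in auto)
    from bij_betw_trans[OF this bij_twist] show ?thesis
      by (simp add: comp_def \<phi>_def[abs_def])
  qed
  have \<phi>_char: "\<phi> x \<in> add_characters" for x
    using bij by (auto simp: bij_betw_def)
  have \<phi>_surj: "\<exists>x. ch = \<phi> x" if "ch \<in> add_characters" for ch
    using bij that by (auto simp: bij_betw_def)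
  have \<phi>_eq: "\<phi> x = \<phi> y \<longleftrightarrow> x = y" for x y
    using bij by (auto simp: bij_betw_def inj_on_eq_iff)
  have \<phi>_div: "(\<lambda>z. \<phi> y z / \<phi> x z) = \<phi> (y - x)" for x y
    by (auto simp: \<phi>_def diff_divide_distrib left_diff_distrib char_diff)
  have equiv: "(\<phi> x, \<phi> y) \<in> dual_equiv D d \<longleftrightarrow> (\<exists>k\<le>d. x \<in> D k \<and> y \<in> D k)" for x y
    using dual[of "x / c" "y / c"] c_nonzero \<phi>_char by (simp add: dual_equiv_def) (simp add: \<phi>_def)
  have cls: "dual_equiv D d `` {\<phi> x} = \<phi> ` D k" if "k \<le> d" "x \<in> D k" for x k
  proof
    show "dual_equiv D d `` {\<phi> x} \<subseteq> \<phi> ` D k"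
    proof
      fix ch assume "ch \<in> dual_equiv D d `` {\<phi> x}"
      then have ch: "(\<phi> x, ch) \<in> dual_equiv D d"
        by simp
      then obtain y where "ch = \<phi> y"
        using \<phi>_surj by (auto simp: dual_equiv_def)
      with ch show "ch \<in> \<phi> ` D k"
        using equiv D_disjoint that by blast
    qed
    show "\<phi> ` D k \<subseteq> dual_equiv D d `` {\<phi> x}"
      using equiv that by blast
  qed
  have quot: "add_characters // dual_equiv D d = (\<lambda>i. \<phi> ` D i) ` {..d}"
  proof
    show "add_characters // dual_equiv D d \<subseteq> (\<lambda>i. \<phi> ` D i) ` {..d}"
      using \<phi>_surj D_cover cls by (fastforce elim!: quotientE)
    show "(\<lambda>i. \<phi> ` D i) ` {..d} \<subseteq> add_characters // dual_equiv D d"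
    proof
      fix E assume "E \<in> (\<lambda>i. \<phi> ` D i) ` {..d}"
      then obtain i x where "i \<le> d" "E = \<phi> ` D i" "x \<in> D i"
        using D_nonempty by fastforce
      then show "E \<in> add_characters // dual_equiv D d"
        using cls[of i x] \<phi>_char by (metis quotientI)
    qed
  qed
  \<comment> \<open>Since \<phi> turns differences of points into quotients of characters,
    translation relations go to translation relations.\<close>
  have rel: "map_prod \<phi> \<phi> ` translation_rel D i =
      {(ch, ch'). ch \<in> add_characters \<and> ch' \<in> add_characters \<and> (\<lambda>x. ch' x / ch x) \<in> \<phi> ` D i}" for i
  proof
    show "map_prod \<phi> \<phi> ` translation_rel D i \<subseteq>
      {(ch, ch'). ch \<in> add_characters \<and> ch' \<in> add_characters \<and> (\<lambda>x. ch' x / ch x) \<in> \<phi> ` D i}"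
      by (auto simp: translation_rel_def \<phi>_div \<phi>_char)
    show "{(ch, ch'). ch \<in> add_characters \<and> ch' \<in> add_characters \<and> (\<lambda>x. ch' x / ch x) \<in> \<phi> ` D i}
      \<subseteq> map_prod \<phi> \<phi> ` translation_rel D i"
    proof clarify
      fix ch ch' w assume asm: "ch \<in> add_characters" "ch' \<in> add_characters"
        and w: "(\<lambda>x. ch' x / ch x) = \<phi> w" "w \<in> D i"
      obtain x y where xy: "ch = \<phi> x" "ch' = \<phi> y"
        using \<phi>_surj asm by meson
      with w have "y - x = w"
        by (simp add: \<phi>_div \<phi>_eq)
      then have "y = x + w"
        by (simp add: diff_eq_eq add.commute)
      with xy w show "(ch, ch') \<in> map_prod \<phi> \<phi> ` translation_rel D i"
        by (force simp: translation_rel_def)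
    qed
  qed
  have "(\<lambda>R. map_prod \<phi> \<phi> ` R) ` {translation_rel D i | i. i \<le> d} = dual_rels D d"
    unfolding dual_rels_def quot image_image rel[symmetric] by auto
  with bij show ?thesis
    unfolding self_dual_translation_def by blast
qed

end

section \<open>Gauss periods of a multiplicative subgroup and their level sets\<close>

text \<open>Finiteness makes the multiplicatively closed set \<open>C\<close> a subgroup. Having
  \<open>- 1\<close> in it gives symmetric classes and lets orthogonality be stated without complex
  conjugation.\<close>

locale mult_subgroup_periods = nontrivial_add_char \<psi> for \<psi> :: "'a::{field,finite} \<Rightarrow> complex" +
  fixes C :: "'a set"
  assumes one_in: "1 \<in> C" and zero_notin: "0 \<notin> C"
    and mult_in: "\<And>x y. x \<in> C \<Longrightarrow> y \<in> C \<Longrightarrow> x * y \<in> C"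
    and minus_one_in: "- 1 \<in> C"
begin

text \<open>This is the function \<open>F\<close> of the overview: the Gauss periods as a function
  on the whole field, with value \<open>card C\<close> at 0.\<close>

definition period :: "'a \<Rightarrow> complex" where
  "period x = (\<Sum>y\<in>C. \<psi> (x * y))"

lemma bij_mult: "u \<in> C \<Longrightarrow> bij_betw ((*) u) C C"
proof -
  assume u: "u \<in> C"
  then have "inj_on ((*) u) C"
    using zero_notin by (auto simp: inj_on_def)
  moreover have "(*) u ` C \<subseteq> C"
    using mult_in u by auto
  ultimately show ?thesis
    by (simp add: bij_betw_def endo_inj_surj)
qed

lemma uminus_in: "x \<in> C \<Longrightarrow> - x \<in> C"
  using mult_in[OF minus_one_in] by simp

lemma mult_in_iff: "u \<in> C \<Longrightarrow> x * u \<in> C \<longleftrightarrow> x \<in> C"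
proof
  assume u: "u \<in> C" and "x * u \<in> C"
  then obtain v where "v \<in> C" "x * u = u * v"
    using bij_betw_imp_surj_on[OF bij_mult[OF u]] by (metis imageE)
  moreover have "u \<noteq> 0"
    using u zero_notin by auto
  ultimately show "x \<in> C"
    by (simp add: mult.commute)
qed (rule mult_in)

lemma period_mult: "u \<in> C \<Longrightarrow> period (x * u) = period x"
  using sum.reindex_bij_betw[OF bij_mult, of u "\<lambda>y. \<psi> (x * y)"] by (simp add: period_def mult.assoc)

lemma period_zero: "period 0 = of_nat (card C)"
  by (simp add: period_def)

lemma card_pos: "card C > 0"
  using one_in by (auto simp: card_gt_0_iff)

text \<open>After expansion, the sum over \<open>x\<close> survives only for
  \<open>y = - (z * y')\<close>. For each \<open>y'\<close> in \<open>C\<close> this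
  \<open>y\<close> lies in \<open>C\<close> exactly when \<open>z\<close> does.\<close>

lemma sum_period_period:
  assumes "z \<noteq> 0"
  shows "(\<Sum>x\<in>UNIV. period x * period (z * x)) =
    (if z \<in> C then of_nat CARD('a) * of_nat (card C) else 0)"
proof -
  have "period x * period (z * x) = (\<Sum>y'\<in>C. \<Sum>y\<in>C. \<psi> ((y + z * y') * x))" for x
  proof -
    have "period x * period (z * x) = period (z * x) * period x"
      by (rule mult.commute)
    also have "\<dots> = (\<Sum>y'\<in>C. \<Sum>y\<in>C. \<psi> ((y + z * y') * x))"
      unfolding period_def sum_product
      by (intro sum.cong refl) (simp add: algebra_simps flip: char_add)
    finally show ?thesis .
  qed
  then have "(\<Sum>x\<in>UNIV. period x * period (z * x)) = (\<Sum>x\<in>UNIV. \<Sum>y'\<in>C. \<Sum>y\<in>C. \<psi> ((y + z * y') * x))"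
    by simp
  also have "\<dots> = (\<Sum>y'\<in>C. \<Sum>x\<in>UNIV. \<Sum>y\<in>C. \<psi> ((y + z * y') * x))"
    by (rule sum.swap)
  also have "\<dots> = (\<Sum>y'\<in>C. \<Sum>y\<in>C. \<Sum>x\<in>UNIV. \<psi> ((y + z * y') * x))"
    by (intro sum.cong refl sum.swap)
  also have "\<dots> = (\<Sum>y'\<in>C. \<Sum>y\<in>C. if y = - (z * y') then of_nat CARD('a) else 0)"
    unfolding sum_twist by (simp add: eq_neg_iff_add_eq_0)
  also have "\<dots> = (\<Sum>y'\<in>C. if z \<in> C then of_nat CARD('a) else 0)"
  proof (rule sum.cong)
    fix y' assume "y' \<in> C"
    then have "- (z * y') \<in> C \<longleftrightarrow> z \<in> C"
      using uminus_in[of "z * y'"] uminus_in[of "- (z * y')"] by (auto simp: mult_in_iff)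
    then show "(\<Sum>y\<in>C. if y = - (z * y') then of_nat CARD('a) else 0) =
        (if z \<in> C then of_nat CARD('a) else (0::complex))"
      by simp
  qed simp
  finally show ?thesis
    by simp
qed

text \<open>Each \<open>u\<close> in \<open>C\<close> permutes \<open>A\<close>, so all
  \<open>card C\<close> inner sums coincide.\<close>

lemma sum_period_class:
  assumes "\<And>x u. u \<in> C \<Longrightarrow> x \<in> A \<Longrightarrow> x * u \<in> A"
  shows "(\<Sum>x\<in>A. period (b * x)) = of_nat (card C) * (\<Sum>x\<in>A. \<psi> (b * x))"
proof -
  have "(\<Sum>x\<in>A. period (b * x)) = (\<Sum>y\<in>C. \<Sum>x\<in>A. \<psi> (b * (x * y)))"
    unfolding period_def by (subst sum.swap) (simp add: mult.assoc)
  also have "\<dots> = (\<Sum>y\<in>C. \<Sum>x\<in>A. \<psi> (b * x))"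
  proof (rule sum.cong)
    fix u assume u: "u \<in> C"
    then have "inj_on (\<lambda>x. x * u) A"
      using zero_notin by (auto simp: inj_on_def)
    moreover have "(\<lambda>x. x * u) ` A \<subseteq> A"
      using assms u by auto
    ultimately have "bij_betw (\<lambda>x. x * u) A A"
      by (simp add: bij_betw_def endo_inj_surj)
    then show "(\<Sum>x\<in>A. \<psi> (b * (x * u))) = (\<Sum>x\<in>A. \<psi> (b * x))"
      by (rule sum.reindex_bij_betw)
  qed simp
  finally show ?thesis
    by simp
qed

text \<open>The classes are described by values of \<open>period\<close> rather than as unions of
  cosets, so that \<open>period\<close> can be pulled out of sums over a class.\<close>

definition level :: "(nat \<Rightarrow> complex) \<Rightarrow> nat \<Rightarrow> 'a set" where
  "level \<beta> i = (if i = 0 then {0} else {x. x \<noteq> 0 \<and> period x = \<beta> i})"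

text \<open>The condition \<open>dual\<close> holds because, for \<open>b \<noteq> 0\<close>, the
  class sums at \<open>b\<close> and the single value \<open>period (c * b)\<close> determine each
  other.\<close>

theorem three_valued_periods_self_dual:
  assumes inj: "inj_on \<beta> {1, 2, 3}"
    and period_values: "\<And>x. x \<noteq> 0 \<Longrightarrow> \<exists>i\<in>{1, 2, 3}. period x = \<beta> i"
    and nonempty: "\<And>i. i \<in> {1, 2, 3} \<Longrightarrow> level \<beta> i \<noteq> {}"
    and s: "s \<in> {1, 2, 3}" and c: "c \<noteq> 0" and coset: "level \<beta> s = (*) c ` C"
  shows "self_dual_partition \<psi> (level \<beta>) 3 c"
proof -
  define S where "S i b = (\<Sum>y\<in>level \<beta> i. \<psi> (b * y))" for i b
  have le3: "i \<le> 3 \<longleftrightarrow> i = 0 \<or> i \<in> {1, 2, 3}" for i :: nat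
    by auto
  have cover: "\<exists>i\<le>3. x \<in> level \<beta> i" for x
  proof (cases "x = 0")
    case False
    then obtain i where "i \<in> {1, 2, 3}" "period x = \<beta> i"
      using period_values by blast
    with False show ?thesis
      by (intro exI[of _ i]) (auto simp: level_def)
  qed (auto simp: level_def)
  have disjoint: "i = j" if "i \<le> 3" "j \<le> 3" "x \<in> level \<beta> i" "x \<in> level \<beta> j" for i j x
    using that inj_onD[OF inj, of i j] by (auto simp: level_def le3 split: if_splits)
  have level_mult: "x * u \<in> level \<beta> i" if "u \<in> C" "x \<in> level \<beta> i" for x u i
    using that zero_notin by (auto simp: level_def period_mult split: if_splits)
  have sum_levels: "sum g UNIV = sum g (level \<beta> 0) + sum g (level \<beta> 1) + sum g (level \<beta> 2) + sum g (level \<beta> 3)"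
    for g :: "'a \<Rightarrow> complex"
  proof -
    have "sum g UNIV = (\<Sum>k\<le>3. sum g (level \<beta> k))"
      using cover disjoint by (rule sum_partition)
    also have "{..3::nat} = {0, 1, 2, 3}"
      by auto
    finally show ?thesis
      by (simp add: add.assoc)
  qed
  have S_0: "S 0 b = 1" for b
    by (simp add: S_def level_def)
  have S_s: "S s b = period (c * b)" for b
  proof -
    have "inj_on ((*) c) C"
      using c by (auto simp: inj_on_def)
    then show ?thesis
      unfolding S_def coset period_def by (subst sum.reindex) (auto simp: algebra_simps)
  qed
  have S_sum: "S 0 b + S 1 b + S 2 b + S 3 b = (if b = 0 then of_nat CARD('a) else 0)" for b
    unfolding S_def sum_levels[symmetric] by (rule sum_twist)
  have in_C_iff: "b \<in> C \<longleftrightarrow> period (c * b) = \<beta> s" if "b \<noteq> 0" for b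
  proof -
    have "b \<in> C \<longleftrightarrow> c * b \<in> level \<beta> s"
      using c by (auto simp: coset)
    then show ?thesis
      using that c s by (auto simp: level_def)
  qed
  \<comment> \<open>This is \<open>sum_period_period\<close> split along the levels: the first
    factor is \<beta>\<open>i\<close> on level \<open>i\<close>, and the point 0 contributes
    \<open>card C\<close> squared.\<close>
  have S_weighted: "of_nat (card C) * (of_nat (card C) + \<beta> 1 * S 1 b + \<beta> 2 * S 2 b + \<beta> 3 * S 3 b) =
      (if period (c * b) = \<beta> s then of_nat CARD('a) * of_nat (card C) else 0)" if b: "b \<noteq> 0" for b
  proof -
    have "(\<Sum>x\<in>level \<beta> i. period x * period (b * x)) = \<beta> i * (of_nat (card C) * S i b)" if "i \<noteq> 0" for i
    proof -
      have "(\<Sum>x\<in>level \<beta> i. period x * period (b * x)) = (\<Sum>x\<in>level \<beta> i. \<beta> i * period (b * x))"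
        using that by (intro sum.cong) (auto simp: level_def)
      also have "\<dots> = \<beta> i * (of_nat (card C) * S i b)"
        by (simp add: sum_period_class level_mult S_def flip: sum_distrib_left)
      finally show ?thesis .
    qed
    moreover have "(\<Sum>x\<in>level \<beta> 0. period x * period (b * x)) = of_nat (card C) * of_nat (card C)"
      by (simp add: level_def period_zero)
    ultimately have "of_nat (card C) * (of_nat (card C) + \<beta> 1 * S 1 b + \<beta> 2 * S 2 b + \<beta> 3 * S 3 b) =
        (\<Sum>x\<in>UNIV. period x * period (b * x))"
      unfolding sum_levels by (simp add: algebra_simps)
    then show ?thesis
      by (simp only: sum_period_period[OF b] in_C_iff[OF b])
  qed
  text \<open>The values on the two remaining classes solve a \<open>2 \<times> 2\<close> linear system
    whose right-hand side depends on \<open>b\<close> only through \<open>period (c * b)\<close>.\<close>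
  have determined: "S i b = S i b'"
    if "i \<le> 3" "b \<noteq> 0" "b' \<noteq> 0" "period (c * b) = period (c * b')" for i b b'
  proof -
    \<comment> \<open>Differences make the system homogeneous; the unknown of index \<open>s\<close>
      vanishes, and distinctness of the two other values of \<beta> forces the rest to
      vanish.\<close>
    define \<Delta> where "\<Delta> i = S i b - S i b'" for i
    have \<Delta>_s: "\<Delta> s = 0"
      using that by (simp add: \<Delta>_def S_s)
    have eq1: "\<Delta> 1 + \<Delta> 2 + \<Delta> 3 = 0"
    proof -
      have "\<Delta> 1 + \<Delta> 2 + \<Delta> 3 = (S 0 b + S 1 b + S 2 b + S 3 b) - (S 0 b' + S 1 b' + S 2 b' + S 3 b')"
        by (simp add: \<Delta>_def S_0)
      then show ?thesis
        unfolding S_sum using that by simp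
    qed
    have eq2: "\<beta> 1 * \<Delta> 1 + \<beta> 2 * \<Delta> 2 + \<beta> 3 * \<Delta> 3 = 0"
    proof -
      have "of_nat (card C) * (of_nat (card C) + \<beta> 1 * S 1 b + \<beta> 2 * S 2 b + \<beta> 3 * S 3 b) =
        of_nat (card C) * (of_nat (card C) + \<beta> 1 * S 1 b' + \<beta> 2 * S 2 b' + \<beta> 3 * S 3 b')"
        using S_weighted[OF that(2)] S_weighted[OF that(3)] that(4) by simp
      then have "of_nat (card C) + \<beta> 1 * S 1 b + \<beta> 2 * S 2 b + \<beta> 3 * S 3 b =
          of_nat (card C) + \<beta> 1 * S 1 b' + \<beta> 2 * S 2 b' + \<beta> 3 * S 3 b'"
        using card_pos by (auto simp del: One_nat_def)
      then show ?thesis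
        unfolding \<Delta>_def by algebra
    qed
    have neq: "\<beta> 1 \<noteq> \<beta> 2" "\<beta> 1 \<noteq> \<beta> 3" "\<beta> 2 \<noteq> \<beta> 3"
      using inj by (auto simp: inj_on_def)
    have "\<Delta> 1 = 0 \<and> \<Delta> 2 = 0 \<and> \<Delta> 3 = 0"
    proof -
      have solve: "x = 0 \<and> y = 0" if "x + y = 0" "a * x + b * y = 0" "a \<noteq> b" for x y a b :: complex
      proof -
        have "y = - x"
          using that(1) by (simp add: eq_neg_iff_add_eq_0 add.commute)
        with that(2) have "(a - b) * x = 0"
          by (simp add: algebra_simps)
        with \<open>y = - x\<close> that(3) show ?thesis
          by simp
      qed
      consider "s = 1" | "s = 2" | "s = 3"
        using s by blast
      then show ?thesis
      proof cases
        case 1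
        then show ?thesis
          using solve[of "\<Delta> 2" "\<Delta> 3" "\<beta> 2" "\<beta> 3"] \<Delta>_s eq1 eq2 neq by simp
      next
        case 2
        then show ?thesis
          using solve[of "\<Delta> 1" "\<Delta> 3" "\<beta> 1" "\<beta> 3"] \<Delta>_s eq1 eq2 neq by simp
      next
        case 3
        then show ?thesis
          using solve[of "\<Delta> 1" "\<Delta> 2" "\<beta> 1" "\<beta> 2"] \<Delta>_s eq1 eq2 neq by simp
      qed
    qed
    then show ?thesis
      using that(1) by (auto simp: \<Delta>_def le3 S_0)
  qed
  show ?thesis
  proof
    show "c \<noteq> 0" "level \<beta> 0 = {0}"
      using c by (auto simp: level_def)
    show "level \<beta> i \<noteq> {}" if "i \<le> 3" for i
      using that nonempty[of i] by (cases "i = 0") (auto simp: level_def le3)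
    show "i = j" if "i \<le> 3" "j \<le> 3" "x \<in> level \<beta> i" "x \<in> level \<beta> j" for i j x
      using disjoint that .
    show "\<exists>i\<le>3. x \<in> level \<beta> i" for x
      by (rule cover)
    show "- x \<in> level \<beta> i" if "i \<le> 3" "x \<in> level \<beta> i" for i x
      using level_mult[OF minus_one_in that(2)] by simp
    fix b b'
    have "(\<forall>i\<le>3. S i b = S i b') \<longleftrightarrow> (\<exists>k\<le>3. c * b \<in> level \<beta> k \<and> c * b' \<in> level \<beta> k)"
    proof
      assume eq: "\<forall>i\<le>3. S i b = S i b'"
      \<comment> \<open>The total of the class sums is nonzero only at 0, so the class sums tell 0
        apart.\<close>
      then have "b = 0 \<longleftrightarrow> b' = 0"
        using S_sum[of b] S_sum[of b'] by (auto split: if_splits)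
      moreover have "period (c * b) = period (c * b')"
        using eq s by (auto simp flip: S_s)
      ultimately show "\<exists>k\<le>3. c * b \<in> level \<beta> k \<and> c * b' \<in> level \<beta> k"
        using cover[of "c * b"] c by (auto simp: level_def split: if_splits)
    next
      assume "\<exists>k\<le>3. c * b \<in> level \<beta> k \<and> c * b' \<in> level \<beta> k"
      then show "\<forall>i\<le>3. S i b = S i b'"
        using determined[of _ b b'] c by (auto simp: level_def split: if_splits)
    qed
    then show "(\<forall>i\<le>3. (\<Sum>y\<in>level \<beta> i. \<psi> (b * y)) = (\<Sum>y\<in>level \<beta> i. \<psi> (b' * y))) \<longleftrightarrow>
        (\<exists>k\<le>3. c * b \<in> level \<beta> k \<and> c * b' \<in> level \<beta> k)"
      by (simp add: S_def)
  qed
qed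

end

section \<open>Application to cyclotomic classes\<close>

theorem theorem2p7:
  fixes p f N :: nat and \<gamma> :: "'a::{field,finite}"
    and \<alpha>1 \<alpha>2 \<alpha>3 :: rat and t u v :: real
  assumes "prime p" and "f \<ge> 1" and "CARD('a) = p ^ f"
    and "N > 2" and "N dvd (CARD('a) - 1)"
    and "primitive_element \<gamma>"
    and "- 1 \<in> cyc_class \<gamma> N 0"
    and "{gauss_period p f \<gamma> N a | a. a < N} = {of_rat \<alpha>1, of_rat \<alpha>2, of_rat \<alpha>3}"
    and "\<alpha>1 < \<alpha>2" and "\<alpha>2 < \<alpha>3"
    and "real_of_rat \<alpha>1 - real_of_rat \<alpha>2 = - t * u"
    and "real_of_rat \<alpha>3 - real_of_rat \<alpha>2 = t * v"
    and "t > 0"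
  defines "I \<equiv> (\<lambda>i::nat. {a. a < N \<and> gauss_period p f \<gamma> N a =
                   of_rat (if i = 1 then \<alpha>1 else if i = 2 then \<alpha>2 else \<alpha>3)})"
  defines "Rs \<equiv> (\<lambda>i::nat. if i = 0 then {0} else (\<Union>j\<in>I i. cyc_class \<gamma> N j))"
  defines "\<R> \<equiv> (\<lambda>i::nat. {(x, y). x - y \<in> Rs i})"
  assumes "card (I 1) = 1 \<or> card (I 3) = 1"
  shows "assoc_scheme (UNIV :: 'a set) \<R> 3 \<and> self_dual_translation Rs 3"
proof -
  let ?\<psi> = "canon_add_char p f :: 'a \<Rightarrow> complex" and ?C = "cyc_class \<gamma> N 0"
  have \<gamma>: "\<gamma> \<noteq> 0" "\<And>x. x \<noteq> 0 \<Longrightarrow> \<exists>k. x = \<gamma> ^ k"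
    using assms(6) by (auto simp: primitive_element_def)
  interpret mult_subgroup_periods ?\<psi> ?C
  proof
    show "?\<psi> \<in> add_characters"
      using canon_add_char_add[OF assms(1,3)] by (auto simp: add_characters_def canon_add_char_def)
    show "\<exists>x. ?\<psi> x \<noteq> 1"
      using canon_add_char_nontrivial[OF assms(1,3,2)] .
    show "1 \<in> ?C"
      unfolding cyc_class_def by (auto intro: exI[of _ 0])
    show "0 \<notin> ?C" "- 1 \<in> ?C"
      using \<gamma>(1) assms(7) by (auto simp: cyc_class_def)
    show "x * y \<in> ?C" if "x \<in> ?C" "y \<in> ?C" for x y
      using that by (auto simp: cyc_class_def simp flip: power_add distrib_left)
  qed
  have class_eq: "cyc_class \<gamma> N a = (*) (\<gamma> ^ a) ` ?C" for a
    by (auto simp: cyc_class_def power_add)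
  have gauss_period_eq: "gauss_period p f \<gamma> N a = period (\<gamma> ^ a)" for a
  proof -
    have "inj_on ((*) (\<gamma> ^ a)) ?C"
      using \<gamma>(1) by (auto simp: inj_on_def)
    then show ?thesis
      unfolding gauss_period_def class_eq[of a] period_def by (subst sum.reindex) auto
  qed
  have in_class: "\<exists>a<N. x \<in> cyc_class \<gamma> N a" if x: "x \<noteq> 0" for x
  proof -
    obtain k where "x = \<gamma> ^ k"
      using \<gamma>(2)[OF x] by blast
    \<comment> \<open>Division with remainder by \<open>N\<close> gives the index of the class
      containing \<open>x\<close>.\<close>
    then have "x = \<gamma> ^ (k mod N + N * (k div N))"
      by simp
    then have "x \<in> cyc_class \<gamma> N (k mod N)"
      unfolding cyc_class_def by blast
    moreover have "k mod N < N"
      using assms(4) by simp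
    ultimately show ?thesis
      by blast
  qed
  have period_class: "period x = gauss_period p f \<gamma> N a" if x: "x \<in> cyc_class \<gamma> N a" for x a
  proof -
    obtain y where "y \<in> ?C" "x = \<gamma> ^ a * y"
      using x unfolding class_eq[of a] by blast
    then show ?thesis
      by (simp add: gauss_period_eq period_mult)
  qed
  \<comment> \<open>The conditional copies the one in \<open>I\<close>, default included, so that
    \<open>Rs\<close> and \<open>level \<beta>\<close> agree as functions, also at indices above
    3.\<close>
  define \<beta> :: "nat \<Rightarrow> complex" where
    "\<beta> i = of_rat (if i = 1 then \<alpha>1 else if i = 2 then \<alpha>2 else \<alpha>3)" for i
  have gauss_period_values: "{gauss_period p f \<gamma> N a | a. a < N} = \<beta> ` {1, 2, 3}"
    unfolding assms(8) by (simp add: \<beta>_def)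
  have Rs: "Rs = level \<beta>"
  proof (rule ext, rule set_eqI)
    fix i x
    have I_eq: "I i = {a. a < N \<and> gauss_period p f \<gamma> N a = \<beta> i}"
      by (simp add: I_def \<beta>_def)
    have zero: "x \<noteq> 0" if "x \<in> cyc_class \<gamma> N a" for a
      using that \<gamma>(1) by (auto simp: cyc_class_def)
    have "x \<in> (\<Union>j\<in>I i. cyc_class \<gamma> N j) \<longleftrightarrow> x \<noteq> 0 \<and> period x = \<beta> i"
      unfolding I_eq using in_class period_class zero by fastforce
    then show "x \<in> Rs i \<longleftrightarrow> x \<in> level \<beta> i"
      by (simp add: Rs_def level_def)
  qed
  obtain s where s: "s \<in> {1, 2, 3}" "card (I s) = 1"
    using assms(17) by auto
  then obtain a where a: "I s = {a}"
    by (auto simp: card_1_singleton_iff)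
  \<comment> \<open>As \<open>I s = {a}\<close>, the class of index \<open>s\<close> is the single
    coset of \<open>\<gamma> ^ a\<close>, which therefore serves as the dilation factor
    \<open>c\<close>.\<close>
  interpret self_dual_partition ?\<psi> "level \<beta>" 3 "\<gamma> ^ a"
  proof (rule three_valued_periods_self_dual)
    show "inj_on \<beta> {1, 2, 3}"
      using assms(9,10) by (auto simp: inj_on_def \<beta>_def)
    show "\<exists>i\<in>{1, 2, 3}. period x = \<beta> i" if "x \<noteq> 0" for x
      using in_class[OF that] period_class gauss_period_values by blast
    show "level \<beta> i \<noteq> {}" if i: "i \<in> {1, 2, 3}" for i
    proof -
      obtain b where "gauss_period p f \<gamma> N b = \<beta> i"
        using imageI[OF i, of \<beta>] unfolding gauss_period_values[symmetric] by force
      then have "\<gamma> ^ b \<in> level \<beta> i"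
        using i \<gamma>(1) gauss_period_eq[of b] by (auto simp: level_def)
      then show ?thesis
        by blast
    qed
    show "level \<beta> s = (*) (\<gamma> ^ a) ` ?C"
      using s(1) a unfolding Rs[symmetric] by (auto simp: Rs_def class_eq[of a])
  qed (use s \<gamma>(1) in auto)
  show ?thesis
    using assoc_scheme_partition self_dual_partition unfolding \<R>_def Rs by blast
qed

end
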